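(* Let an affine body have time-dependent affine matrix $\mathbf{A}(t)\in\mathbb{R}^{3\times3}$ and suppose the body is under a rigid transformation, with rotation $\mathbf{R}(t)\in\mathrm{SO}(3)$ (differentiable in $t$) and angular velocity $\omega(t)\in\mathbb{R}^3$ expressed in the world frame. Then $$\dot{\mathbf{A}}=[\omega]_\times\mathbf{A}.$$
   Context: An affine body has kinematics $\mathbf{y}=\mathbf{A}(t)\mathbf{x}+\mathbf{c}(t)$, where $\mathbf{x}$ are material coordinates, $\mathbf{A}(t)\in\mathbb{R}^{3\times3}$ and $\mathbf{c}(t)\in\mathbb{R}^3$. Write the polar decomposition $\mathbf{A}(t)=\mathbf{R}(t)\mathbf{S}(t)$ with $\mathbf{R}(t)$ a rotation and $\mathbf{S}(t)$ symmetric positive semi-definite. The body is "under a rigid transformation" when the factor $\mathbf{S}$ remains unchanged in time, so $\mathbf{A}(t)=\mathbf{R}(t)\mathbf{S}$ with $\mathbf{S}$ constant. For $\omega=(\omega_x,\omega_y,\omega_z)$, $$[\omega]_\times=\begin{bmatrix}0&-\omega_z&\omega_y\\ \omega_z&0&-\omega_x\\ -\omega_y&\omega_x&0\end{bmatrix},$$ and the angular velocity $\omega(t)$ of the rotation $\mathbf{R}(t)$ is the vector for which $\dot{\mathbf{R}}(t)=[\omega(t)]_\times\mathbf{R}(t)$. *)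

theory Defs
  imports "HOL-Analysis.Analysis"
begin

definition cross_matrix :: "real^3 \<Rightarrow> real^3^3" where
  "cross_matrix w = vector
     [vector [0, - w$3, w$2],
      vector [w$3, 0, - w$1],
      vector [- w$2, w$1, 0]]"

definition positive_semidefinite :: "real^'n^'n \<Rightarrow> bool" where
  "positive_semidefinite S \<longleftrightarrow> transpose S = S \<and> (\<forall>x. 0 \<le> x \<bullet> (S *v x))"

definition polar_decomposition :: "real^'n^'n \<Rightarrow> real^'n^'n \<Rightarrow> real^'n^'n \<Rightarrow> bool" where
  "polar_decomposition A R S \<longleftrightarrow> A = R ** S \<and> rotation_matrix R \<and> positive_semidefinite S"

(* R is an argument because a singular A t does not determine its rotation factor. *)
definition rigid_transformation_on ::
  "real set \<Rightarrow> (real \<Rightarrow> real^'n^'n) \<Rightarrow> (real \<Rightarrow> real^'n^'n) \<Rightarrow> bool" where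
  "rigid_transformation_on T A R \<longleftrightarrow> (\<exists>S. \<forall>t\<in>T. polar_decomposition (A t) (R t) S)"

(* The description is proper for every differentiable path of rotations on a
   nondegenerate interval T: differentiating R ** transpose R = mat 1 shows that
   R' ** transpose R is skew-symmetric, hence of the form cross_matrix w for exactly one w.
   The derivative is one-sided at an endpoint of T. *)
definition angular_velocity :: "real set \<Rightarrow> (real \<Rightarrow> real^3^3) \<Rightarrow> real \<Rightarrow> real^3" where
  "angular_velocity T R t =
     (THE w. (R has_vector_derivative cross_matrix w ** R t) (at t within T))"

end

theory Submission
  imports Defs
begin

text \<open>Rigidity gives \<open>A = R ** S\<close> on \<open>T\<close> with one constant
  \<open>S\<close>, so the derivative of \<open>A\<close> is that of \<open>R\<close> times
  \<open>S\<close>, and the claim follows from the defining equation of the angular velocity by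
  associativity. The substance is that this equation holds at all, since
  \<open>angular_velocity\<close> is a definite description. Existence: differentiating the constant
  \<open>R ** transpose R\<close> shows that \<open>D ** transpose R\<close>, with \<open>D\<close>
  the derivative of \<open>R\<close>, is skew (\<open>orthogonal_path_derivative_skew\<close>), and
  a skew 3x3 matrix is a cross matrix (\<open>skew_eq_cross_matrix\<close>). Uniqueness: derivatives
  within a nondegenerate interval are unique, \<open>R\<close> is invertible, and
  \<open>cross_matrix\<close> is injective.\<close>

lemma bounded_bilinear_matrix_mult:
  "bounded_bilinear ((**) :: real^'n^'m \<Rightarrow> real^'p^'n \<Rightarrow> real^'p^'m)"
  unfolding bilinear_conv_bounded_bilinear [symmetric] bilinear_def
  by (auto intro!: linearI simp: matrix_matrix_mult_def vec_eq_iff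
        sum.distrib sum_distrib_left algebra_simps)

lemma bounded_linear_transpose:
  "bounded_linear (transpose :: real^'n^'m \<Rightarrow> real^'m^'n)"
  unfolding linear_conv_bounded_linear [symmetric]
  by (auto intro!: linearI simp: transpose_def vec_eq_iff)

text \<open>Skewness kills the diagonal and leaves three free entries; the witness reads them off
  where \<open>cross_matrix\<close> carries a plus sign.\<close>

lemma skew_eq_cross_matrix:
  fixes W :: "real^3^3"
  assumes "transpose W = - W"
  shows "W = cross_matrix (vector [W$3$2, W$1$3, W$2$1])"
proof -
  have skew: "W$j$i = - W$i$j" for i j
    using arg_cong [OF assms, of "\<lambda>M. M$i$j"] by (simp add: transpose_def)
  have diag: "W$i$i = 0" for i
    using skew [of i i] by simp
  show ?thesis
    using skew [of 1 2] skew [of 1 3] skew [of 2 3] diag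
    by (simp add: cross_matrix_def vec_eq_iff forall_3)
qed

lemma cross_matrix_inject: "cross_matrix v = cross_matrix w \<longleftrightarrow> v = w"
  by (auto simp: cross_matrix_def vec_eq_iff forall_3)

lemma orthogonal_path_derivative_skew:
  fixes R :: "real \<Rightarrow> real^'n^'n"
  assumes deriv: "(R has_vector_derivative D) (at t within T)"
    and orth: "\<And>s. s \<in> T \<Longrightarrow> orthogonal_matrix (R s)"
    and "t \<in> T" and nontriv: "at t within T \<noteq> bot"
  shows "transpose (D ** transpose (R t)) = - (D ** transpose (R t))"
proof -
  have "((\<lambda>s. R s ** transpose (R s)) has_vector_derivative
      R t ** transpose D + D ** transpose (R t)) (at t within T)"
    by (intro bounded_bilinear.has_vector_derivative [OF bounded_bilinear_matrix_mult]
        bounded_linear.has_vector_derivative [OF bounded_linear_transpose] deriv)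
  \<comment> \<open>Orthogonality is known only on \<open>T\<close>, where the product is constantly
    \<open>mat 1\<close>; this suffices for the derivative within \<open>T\<close>.\<close>
  moreover have "((\<lambda>s. R s ** transpose (R s)) has_vector_derivative 0) (at t within T)"
    by (rule has_vector_derivative_transform [OF \<open>t \<in> T\<close> _ has_vector_derivative_const])
      (use orth in \<open>auto simp: orthogonal_matrix_def\<close>)
  ultimately have "R t ** transpose D + D ** transpose (R t) = 0"
    by (rule vector_derivative_unique_within [OF nontriv])
  \<comment> \<open>The first summand is the transpose of the second.\<close>
  then show ?thesis
    by (simp add: matrix_transpose_mul eq_neg_iff_add_eq_0)
qed

text \<open>This discharges the definite description: the differential equation for \<open>R\<close>
  has exactly one solution \<open>w\<close>.\<close>

lemma has_vector_derivative_angular_velocity: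
  assumes diff: "R differentiable (at t within T)"
    and rot: "\<And>s. s \<in> T \<Longrightarrow> rotation_matrix (R s)"
    and "t \<in> T" and nontriv: "at t within T \<noteq> bot"
  shows "(R has_vector_derivative cross_matrix (angular_velocity T R t) ** R t) (at t within T)"
proof -
  from diff obtain D where D: "(R has_vector_derivative D) (at t within T)"
    using vector_derivative_works by blast
  have orth: "orthogonal_matrix (R s)" if "s \<in> T" for s
    using rot [OF that] by (simp add: rotation_matrix_def)
  \<comment> \<open>The first identity recovers \<open>D\<close> from
    \<open>D ** transpose (R t)\<close>; the second cancels \<open>R t\<close> on the right in the
    uniqueness part.\<close>
  have mult_R: "M ** transpose (R t) ** R t = M" "M ** R t ** transpose (R t) = M" for M :: "real^3^3"
    using orth [OF \<open>t \<in> T\<close>]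
    by (simp_all add: orthogonal_matrix_def flip: matrix_mul_assoc)
  obtain w where w: "D ** transpose (R t) = cross_matrix w"
    using skew_eq_cross_matrix [OF orthogonal_path_derivative_skew [OF D orth \<open>t \<in> T\<close> nontriv]]
    by blast
  then have D_eq: "D = cross_matrix w ** R t"
    by (metis mult_R(1))
  show ?thesis
    unfolding angular_velocity_def
  proof (rule theI)
    show "(R has_vector_derivative cross_matrix w ** R t) (at t within T)"
      using D D_eq by simp
  next
    fix v
    assume "(R has_vector_derivative cross_matrix v ** R t) (at t within T)"
    then have "cross_matrix v ** R t = cross_matrix w ** R t"
      using D D_eq by (metis vector_derivative_unique_within [OF nontriv])
    then show "v = w"
      by (metis mult_R(2) cross_matrix_inject)
  qed
qed

text \<open>At an isolated point every vector would be a derivative. A connected set with more than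
  one point has no isolated points, and nonempty interior excludes a singleton.\<close>

lemma interval_at_within_neq_bot:
  fixes T :: "real set"
  assumes "is_interval T" and "interior T \<noteq> {}" and "t \<in> T"
  shows "at t within T \<noteq> bot"
proof -
  have "T \<noteq> {t}"
    using assms(2) by auto
  then have "t islimpt T"
    using assms by (intro connected_imp_perfect) (auto simp: is_interval_connected)
  then show ?thesis
    by (simp add: trivial_limit_within)
qed

theorem lemma1:
  fixes T :: "real set" and A R :: "real \<Rightarrow> real^3^3"
  assumes "is_interval T" and "interior T \<noteq> {}"
    and "rigid_transformation_on T A R"
    and "R differentiable_on T"
  shows "\<forall>t\<in>T. (A has_vector_derivative cross_matrix (angular_velocity T R t) ** A t) (at t within T)"
proof
  fix t
  assume t: "t \<in> T"
  obtain S where S: "\<And>s. s \<in> T \<Longrightarrow> A s = R s ** S"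
    and rot: "\<And>s. s \<in> T \<Longrightarrow> rotation_matrix (R s)"
    using assms(3) unfolding rigid_transformation_on_def polar_decomposition_def by blast
  have "(R has_vector_derivative cross_matrix (angular_velocity T R t) ** R t) (at t within T)"
    using assms(4) t interval_at_within_neq_bot [OF assms(1,2) t]
    by (intro has_vector_derivative_angular_velocity rot) (auto simp: differentiable_on_def)
  then have "((\<lambda>s. R s ** S) has_vector_derivative
      cross_matrix (angular_velocity T R t) ** R t ** S) (at t within T)"
    by (rule bounded_linear.has_vector_derivative
        [OF bounded_bilinear.bounded_linear_left [OF bounded_bilinear_matrix_mult]])
  \<comment> \<open>\<open>A\<close> and \<open>R ** S\<close> agree on \<open>T\<close>, which
    contains \<open>t\<close>, so they share derivatives within \<open>T\<close>.\<close>
  then have "(A has_vector_derivative cross_matrix (angular_velocity T R t) ** R t ** S) (at t within T)"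
    by (rule has_vector_derivative_transform [OF t S, rotated])
  then show "(A has_vector_derivative cross_matrix (angular_velocity T R t) ** A t) (at t within T)"
    by (simp add: S [OF t] matrix_mul_assoc)
qed

end
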